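(* Let $d,k\ge 1$ be integers, $c_k\ge 3\sqrt{k}$ a real number and $\mathbf{u}_0\in\mathbb{R}^d$, and let $F:\mathbb{R}^d\to\mathbb{R}$ be the weight-sharing objective defined in the context. Then $F$ is strongly convex, is minimized at $\mathbf{u}_0$, and satisfies $$\frac{\max_{\mathbf{w}_0}\lambda_{\max}(\nabla^2F(\mathbf{w}_0))}{\min_{\mathbf{w}_0}\lambda_{\min}(\nabla^2F(\mathbf{w}_0))}\le 5,$$ where $\lambda_{\max}(M)$ and $\lambda_{\min}(M)$ are the top and bottom eigenvalues of a positive definite matrix $M$ (max and min over $\mathbf{w}_0\in\mathbb{R}^d$ are understood as supremum and infimum). Hence, for every $\epsilon>0$, gradient descent starting from any point $\mathbf{w}^{(0)}\in\mathbb{R}^d$, with an appropriate step size, reaches a point $\mathbf{w}$ satisfying $\|\mathbf{w}-\mathbf{u}_0\|\le\epsilon$ in at most $\max\{0,\lceil 5\log(\|\mathbf{w}^{(0)}-\mathbf{u}_0\|/\epsilon)\rceil\}$ iterations (with $\log 0=-\infty$).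
   Context: For $\mathbf{x}=(\mathbf{x}_1,\ldots,\mathbf{x}_k)\in(\mathbb{R}^d)^k$ and a single shared weight vector $\mathbf{w}_0\in\mathbb{R}^d$, let $$p_{\mathbf{w}_0}(\mathbf{x})=c_k\mathbf{w}_0^\top\mathbf{x}_1+\cos\left(\sum_{i=1}^k\mathbf{w}_0^\top\mathbf{x}_i\right).$$ The weight-sharing (WS) objective is $$F(\mathbf{w}_0)=\mathbb{E}_{\mathbf{x}}\left[\tfrac12\left(p_{\mathbf{w}_0}(\mathbf{x})-p_{\mathbf{u}_0}(\mathbf{x})\right)^2\right],\qquad\mathbf{w}_0\in\mathbb{R}^d,$$ where $\mathbf{x}$ is standard Gaussian in $\mathbb{R}^{dk}$. Gradient descent with step size $\eta>0$ is the iteration $\mathbf{w}^{(t+1)}=\mathbf{w}^{(t)}-\eta\nabla F(\mathbf{w}^{(t)})$. $\|\cdot\|$ is the Euclidean norm and $\log$ is the natural logarithm. *)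

theory Defs
  imports "HOL-Probability.Probability"
begin

definition std_gaussian :: "(real^'d) measure" where
  "std_gaussian = density lborel (\<lambda>x. ennreal (\<Prod>j\<in>UNIV. std_normal_density (x $ j)))"

text \<open>A point of the \<open>k\<close>-fold product of \<open>real^'d\<close> is a function on \<open>{1..k}\<close>, so that the
  standard Gaussian in dimension \<open>CARD('d) * k\<close> is the product of \<open>k\<close> copies of the standard
  Gaussian on \<open>real^'d\<close>.\<close>

definition gaussian_input :: "nat \<Rightarrow> (nat \<Rightarrow> real^'d) measure" where
  "gaussian_input k = (\<Pi>\<^sub>M i\<in>{1..k}. std_gaussian)"

definition ws_predictor :: "nat \<Rightarrow> real \<Rightarrow> real^'d \<Rightarrow> (nat \<Rightarrow> real^'d) \<Rightarrow> real" where
  "ws_predictor k c w x = c * (w \<bullet> x 1) + cos (\<Sum>i\<in>{1..k}. w \<bullet> x i)"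

definition ws_objective :: "nat \<Rightarrow> real \<Rightarrow> real^'d \<Rightarrow> real^'d \<Rightarrow> real" where
  "ws_objective k c u w =
     (LINT x|gaussian_input k. 1/2 * (ws_predictor k c w x - ws_predictor k c u x)\<^sup>2)"

definition strongly_convex :: "('a::real_normed_vector \<Rightarrow> real) \<Rightarrow> bool" where
  "strongly_convex f \<longleftrightarrow>
     (\<exists>m>0. \<forall>x y. \<forall>t\<in>{0..1}. f ((1 - t) *\<^sub>R x + t *\<^sub>R y)
        \<le> (1 - t) * f x + t * f y - m / 2 * t * (1 - t) * (norm (x - y))\<^sup>2)"

text \<open>Both \<open>gradient\<close> and \<open>hessian\<close> are only meaningful at points where \<open>f\<close>, respectively
  \<open>gradient f\<close>, is differentiable.\<close>

definition gradient :: "('a::real_inner \<Rightarrow> real) \<Rightarrow> 'a \<Rightarrow> 'a" where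
  "gradient f x = (THE g. GDERIV f x :> g)"

definition hessian :: "(real^'n \<Rightarrow> real) \<Rightarrow> real^'n \<Rightarrow> real^'n^'n" where
  "hessian f x = jacobian (gradient f) (at x)"

definition eigenvalues :: "real^'n^'n \<Rightarrow> real set" where
  "eigenvalues A = {l. \<exists>v. v \<noteq> 0 \<and> A *v v = l *\<^sub>R v}"

text \<open>The set of eigenvalues is always finite; it is nonempty for symmetric matrices, the only
  ones to which the next two functions are meant to be applied.\<close>

definition lambda_max :: "real^'n^'n \<Rightarrow> real" where
  "lambda_max A = Max (eigenvalues A)"

definition lambda_min :: "real^'n^'n \<Rightarrow> real" where
  "lambda_min A = Min (eigenvalues A)"

fun gd_iterate :: "real \<Rightarrow> ('a::real_inner \<Rightarrow> real) \<Rightarrow> 'a \<Rightarrow> nat \<Rightarrow> 'a" where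
  "gd_iterate \<eta> f w 0 = w"
| "gd_iterate \<eta> f w (Suc t) =
     gd_iterate \<eta> f w t - \<eta> *\<^sub>R gradient f (gd_iterate \<eta> f w t)"

end

theory Submission
  imports Defs
begin

text \<open>
  The cross term of the linear and the cosine part of the predictor is odd in the input, so it has
  mean zero, and the remaining expectations are values of the characteristic function of a
  Gaussian. Hence, up to a constant, \<open>F w\<close> is \<open>c\<^sup>2/2 * \<parallel>w - u\<parallel>\<^sup>2\<close> plus a combination of three
  Gaussian bumps centred at \<open>0\<close>, \<open>u\<close> and \<open>-u\<close>, whose Hessian has operator norm at most \<open>4 * k\<close>.
  Since \<open>c\<^sup>2 \<ge> 9 * k\<close>, all eigenvalues of the Hessian of \<open>F\<close> lie in \<open>[c\<^sup>2 - 4k, c\<^sup>2 + 4k]\<close>, with ratio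
  at most \<open>13/5\<close>. As the bumps have zero total gradient at \<open>u\<close>, a gradient step of size \<open>1/c\<^sup>2\<close>
  contracts the distance to \<open>u\<close> by the factor \<open>4/9 < exp (-1/5)\<close>.
\<close>

subsection \<open>Gaussian integrals\<close>

lemma prod_Basis_vec:
  "(\<Prod>b\<in>(Basis :: (real^'n) set). f b) = (\<Prod>j\<in>UNIV. f (axis j 1))"
proof -
  have *: "(Basis :: (real^'n) set) = range (\<lambda>j. axis j 1)"
    by (auto simp: Basis_vec_def)
  have inj: "inj (\<lambda>j. axis j (1::real) :: real^'n)"
    by (auto simp: inj_def axis_eq_axis)
  show ?thesis
    unfolding * prod.reindex[OF inj] by simp
qed

text \<open>Fubini for an integrand that factors over the coordinates: \<open>lborel\<close> is the
  image of a product of one-dimensional Lebesgue measures. Complex values allow its use for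
  characteristic functions.\<close>

lemma integral_lborel_prod:
  fixes f :: "'a::euclidean_space \<Rightarrow> real \<Rightarrow> complex"
  assumes "\<And>b. b \<in> Basis \<Longrightarrow> integrable lborel (f b)"
  shows "(LINT x|lborel. (\<Prod>b\<in>Basis. f b (x \<bullet> b))) = (\<Prod>b\<in>Basis. (LINT t|lborel. f b t))"
proof -
  interpret product_sigma_finite "\<lambda>_::'a. lborel :: real measure" ..
  have [measurable]: "f b \<in> borel_measurable borel" if "b \<in> Basis" for b
    using borel_measurable_integrable[OF assms[OF that]] by simp
  have "(LINT x|lborel. (\<Prod>b\<in>Basis. f b (x \<bullet> b))) =
      (LINT g|(\<Pi>\<^sub>M b\<in>Basis. lborel). (\<Prod>b\<in>(Basis::'a set). f b (g b)))"
    by (subst lborel_eq) (simp add: integral_distr)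
  also have "\<dots> = (\<Prod>b\<in>Basis. (LINT t|lborel. f b t))"
    by (rule product_integral_prod) (use assms in auto)
  finally show ?thesis .
qed

lemma std_gaussian_density_eq:
  "(\<Prod>j\<in>UNIV. std_normal_density (x $ j)) =
     (\<Prod>b\<in>Basis. std_normal_density ((x :: real^'d) \<bullet> b))"
  by (simp add: prod_Basis_vec inner_axis)

lemma sets_std_gaussian [simp, measurable_cong]: "sets std_gaussian = sets borel"
  and space_std_gaussian [simp]: "space std_gaussian = UNIV"
  by (simp_all add: std_gaussian_def)

lemma prob_space_std_gaussian: "prob_space (std_gaussian :: (real^'d) measure)"
proof
  have "emeasure std_gaussian (space std_gaussian :: (real^'d) set) =
      (\<integral>\<^sup>+x. (\<Prod>b\<in>Basis. ennreal (std_normal_density ((x::real^'d) \<bullet> b))) \<partial>lborel)"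
    by (simp add: std_gaussian_def emeasure_density std_gaussian_density_eq prod_ennreal)
  also have "\<dots> = (\<Prod>b\<in>(Basis :: (real^'d) set). \<integral>\<^sup>+t. ennreal (std_normal_density t) \<partial>lborel)"
    by (subst nn_integral_lborel_prod) auto
  also have "(\<integral>\<^sup>+t. ennreal (std_normal_density t) \<partial>lborel) = 1"
    using prob_space.emeasure_space_1[OF prob_space_normal_density[of 1 0]]
    by (simp add: emeasure_density)
  finally show "emeasure std_gaussian (space std_gaussian :: (real^'d) set) = 1"
    by simp
qed

text \<open>Both the density and \<open>iexp (a \<bullet> x)\<close> factor over the basis, so only
  the one-dimensional characteristic function is needed.\<close>

lemma integral_std_gaussian_iexp:
  "(CLINT x|std_gaussian. iexp (a \<bullet> x)) = complex_of_real (exp (- (norm (a::real^'d))\<^sup>2 / 2))"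
proof -
  have norm_sum: "(norm a)\<^sup>2 = (\<Sum>j\<in>UNIV. (a $ j)\<^sup>2)"
    by (simp add: norm_vec_def L2_set_def sum_nonneg)
  have int: "integrable lborel (\<lambda>t. std_normal_density t *\<^sub>R iexp (s * t))" for s :: real
  proof -
    interpret real_distribution std_normal_distribution by (rule real_dist_normal_dist)
    have "integrable std_normal_distribution (\<lambda>t. iexp (s * t))"
      by (intro integrable_iexp) auto
    then show ?thesis
      by (subst (asm) integrable_density) auto
  qed
  have char1: "(LINT t|lborel. std_normal_density t *\<^sub>R iexp (s * t)) = complex_of_real (exp (- s\<^sup>2 / 2))"
    for s :: real
    using fun_cong[OF char_std_normal_distribution, of s]
    unfolding char_def by (subst (asm) integral_density) auto
  have "(CLINT x|std_gaussian. iexp (a \<bullet> x)) =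
      (LINT x|lborel. (\<Prod>b\<in>Basis. std_normal_density (x \<bullet> b)) *\<^sub>R iexp (a \<bullet> x))"
    unfolding std_gaussian_def
    by (subst integral_density) (auto simp: std_gaussian_density_eq intro!: AE_I2 prod_nonneg)
  also have "\<dots> = (LINT x|lborel. (\<Prod>b\<in>Basis. std_normal_density (x \<bullet> b) *\<^sub>R iexp ((a \<bullet> b) * (x \<bullet> b))))"
  proof (intro Bochner_Integration.integral_cong refl)
    fix x :: "real^'d"
    have "a \<bullet> x = (\<Sum>b\<in>Basis. (a \<bullet> b) * (x \<bullet> b))"
      by (rule euclidean_inner)
    then show "(\<Prod>b\<in>Basis. std_normal_density (x \<bullet> b)) *\<^sub>R iexp (a \<bullet> x) =
        (\<Prod>b\<in>Basis. std_normal_density (x \<bullet> b) *\<^sub>R iexp ((a \<bullet> b) * (x \<bullet> b)))"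
      by (simp add: exp_sum sum_distrib_left prod.distrib scaleR_conv_of_real)
  qed
  also have "\<dots> = (\<Prod>b\<in>Basis. complex_of_real (exp (- (a \<bullet> b)\<^sup>2 / 2)))"
    by (subst integral_lborel_prod) (simp_all only: int char1)
  also have "\<dots> = complex_of_real (exp (- (norm a)\<^sup>2 / 2))"
    by (simp add: prod_Basis_vec inner_axis norm_sum exp_sum[symmetric] sum_negf sum_divide_distrib
        flip: of_real_prod)
  finally show ?thesis .
qed

text \<open>The two laws have the same characteristic function, so Levy uniqueness applies. This
  reduces moments of \<open>a \<bullet> x\<close> to those of a standard normal variable.\<close>

lemma distr_std_gaussian_inner:
  "distr std_gaussian borel (\<lambda>x. a \<bullet> x) =
     distr std_normal_distribution borel (\<lambda>z. norm (a::real^'d) * z)"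
proof (rule Levy_uniqueness)
  interpret G: prob_space "std_gaussian :: (real^'d) measure" by (rule prob_space_std_gaussian)
  interpret N: real_distribution std_normal_distribution by (rule real_dist_normal_dist)
  show "real_distribution (distr std_gaussian borel (\<lambda>x. a \<bullet> x))"
    by (rule G.real_distribution_distr) simp
  show "real_distribution (distr std_normal_distribution borel (\<lambda>z. norm a * z))"
    by (rule N.real_distribution_distr) simp
  show "char (distr std_gaussian borel (\<lambda>x. a \<bullet> x)) =
      char (distr std_normal_distribution borel (\<lambda>z. norm a * z))"
  proof
    fix t :: real
    have "char (distr std_gaussian borel (\<lambda>x. a \<bullet> x)) t = complex_of_real (exp (- (norm (t *\<^sub>R a))\<^sup>2 / 2))"
      using integral_std_gaussian_iexp[of "t *\<^sub>R a"] by (simp add: char_def integral_distr)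
    also have "\<dots> = char std_normal_distribution (t * norm a)"
      by (simp add: char_std_normal_distribution power_mult_distrib)
    also have "\<dots> = char (distr std_normal_distribution borel (\<lambda>z. norm a * z)) t"
      by (simp add: char_def integral_distr mult.assoc)
    finally show "char (distr std_gaussian borel (\<lambda>x. a \<bullet> x)) t =
        char (distr std_normal_distribution borel (\<lambda>z. norm a * z)) t" .
  qed
qed

lemma integral_std_gaussian_inner_power2:
  "(LINT x|std_gaussian. (a \<bullet> x)\<^sup>2) = (norm (a::real^'d))\<^sup>2"
proof -
  have "(LINT x|std_gaussian. (a \<bullet> x)\<^sup>2) = (LINT y|distr std_gaussian borel (\<lambda>x. a \<bullet> x). y\<^sup>2)"
    by (simp add: integral_distr)
  also have "\<dots> = (LINT z|std_normal_distribution. (norm a)\<^sup>2 * z\<^sup>2)"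
    by (simp add: distr_std_gaussian_inner integral_distr power_mult_distrib)
  also have "\<dots> = (norm a)\<^sup>2"
    using std_normal_distribution_even_moments(1)[of 1] by simp
  finally show ?thesis .
qed

lemma integrable_std_gaussian_inner_power:
  "integrable std_gaussian (\<lambda>x. ((a::real^'d) \<bullet> x) ^ n)"
proof -
  have "integrable (distr std_normal_distribution borel (\<lambda>z. norm a * z)) (\<lambda>y. y ^ n)"
    using integrable_std_normal_distribution_moment[of n]
    by (subst integrable_distr_eq) (auto simp: power_mult_distrib)
  then have "integrable (distr std_gaussian borel (\<lambda>x. a \<bullet> x)) (\<lambda>y. y ^ n)"
    by (simp add: distr_std_gaussian_inner)
  then show ?thesis
    by (subst (asm) integrable_distr_eq) auto
qed

text \<open>Lebesgue measure is invariant under reflection and the density is even.\<close>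

lemma distr_std_gaussian_uminus:
  "distr std_gaussian borel uminus = (std_gaussian :: (real^'d) measure)"
proof -
  have lb: "distr lborel borel uminus = (lborel :: (real^'d) measure)"
    using lborel_affine[of "-1" "0 :: real^'d"] by (simp add: density_1)
  have "distr std_gaussian borel uminus =
     distr (density lborel ((\<lambda>x. ennreal (\<Prod>j\<in>UNIV. std_normal_density (x $ j))) \<circ> uminus))
      borel (uminus :: real^'d \<Rightarrow> _)"
    by (simp add: std_gaussian_def comp_def std_normal_density_def)
  also have "\<dots> = density (distr lborel borel uminus) (\<lambda>x. ennreal (\<Prod>j\<in>UNIV. std_normal_density (x $ j)))"
    by (subst density_distr) (auto simp: comp_def)
  finally show ?thesis
    by (simp add: lb std_gaussian_def)
qed

section \<open>The Gaussian product measure on k input blocks\<close>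

lemma sets_gaussian_input [measurable_cong]:
  "sets (gaussian_input k) = sets (\<Pi>\<^sub>M i\<in>{1..k}. (borel :: (real^'d) measure))"
  unfolding gaussian_input_def by (rule sets_PiM_cong) auto

lemma prob_space_gaussian_input: "prob_space (gaussian_input k :: (nat \<Rightarrow> real^'d) measure)"
  unfolding gaussian_input_def by (rule prob_space_PiM) (rule prob_space_std_gaussian)

lemma distr_gaussian_input_component:
  assumes "i \<in> {1..k}"
  shows "distr (gaussian_input k) std_gaussian (\<lambda>x. x i) = (std_gaussian :: (real^'d) measure)"
proof -
  interpret product_prob_space "\<lambda>_::nat. std_gaussian :: (real^'d) measure" "{1..k}"
    by (simp add: product_prob_space_def product_sigma_finite_def prob_space_std_gaussian
        product_prob_space_axioms_def prob_space_imp_sigma_finite)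
  show ?thesis
    unfolding gaussian_input_def by (rule PiM_component[OF assms])
qed

text \<open>Reflection preserves the product measure, so the integral equals its own negative.
  Points of the product are \<open>undefined\<close> outside \<open>{1..k}\<close>, hence the
  restricted negation.\<close>

lemma integral_gaussian_input_odd:
  fixes h :: "(nat \<Rightarrow> real^'d) \<Rightarrow> real"
  assumes [measurable]: "h \<in> borel_measurable (gaussian_input k)"
    and odd: "\<And>x. h (\<lambda>i\<in>{1..k}. - x i) = - h x"
  shows "(LINT x|gaussian_input k. h x) = 0"
proof -
  have inv: "distr (gaussian_input k) (gaussian_input k) (compose {1..k} uminus) =
      (gaussian_input k :: (nat \<Rightarrow> real^'d) measure)"
  proof -
    have "distr std_gaussian std_gaussian uminus = (std_gaussian :: (real^'d) measure)"
      using distr_std_gaussian_uminus by (simp cong: distr_cong)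
    moreover have "(uminus :: real^'d \<Rightarrow> _) \<in> measurable std_gaussian std_gaussian"
      by measurable
    ultimately show ?thesis
      unfolding gaussian_input_def
      by (subst distr_PiM_finite_prob_space') (auto intro: prob_space_std_gaussian)
  qed
  have "compose {1..k} uminus \<in> measurable (gaussian_input k) (gaussian_input k :: (nat \<Rightarrow> real^'d) measure)"
    unfolding compose_def gaussian_input_def by (rule measurable_restrict) measurable
  then have "(LINT x|gaussian_input k. h x) = (LINT x|gaussian_input k. h (compose {1..k} uminus x))"
    by (subst (1) inv[symmetric]) (simp add: integral_distr)
  also have "\<dots> = - (LINT x|gaussian_input k. h x)"
    by (simp add: compose_def odd del: One_nat_def)
  finally show ?thesis by simp
qed

text \<open>The cosine is the real part of \<open>iexp\<close>, which turns the sum over independent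
  blocks into a product of k equal factors.\<close>

lemma integral_gaussian_input_cos:
  "(LINT x|gaussian_input k. cos (\<Sum>i\<in>{1..k}. a \<bullet> x i)) = exp (- real k * (norm (a::real^'d))\<^sup>2 / 2)"
proof -
  interpret prob_space "gaussian_input k :: (nat \<Rightarrow> real^'d) measure" by (rule prob_space_gaussian_input)
  interpret G: prob_space "std_gaussian :: (real^'d) measure" by (rule prob_space_std_gaussian)
  interpret product_sigma_finite "\<lambda>_::nat. std_gaussian :: (real^'d) measure"
    by (simp add: product_sigma_finite_def prob_space_imp_sigma_finite prob_space_std_gaussian)
  have "(CLINT x|gaussian_input k. iexp (\<Sum>i\<in>{1..k}. a \<bullet> x i)) =
      (CLINT x|gaussian_input k. (\<Prod>i\<in>{1..k}. iexp (a \<bullet> x i)))"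
    by (simp add: exp_sum sum_distrib_left)
  also have "\<dots> = (\<Prod>i\<in>{1..k}. (CLINT x|std_gaussian. iexp (a \<bullet> x)))"
    unfolding gaussian_input_def
    by (rule product_integral_prod) (auto intro!: G.integrable_const_bound[where B = 1])
  also have "\<dots> = complex_of_real (exp (- real k * (norm a)\<^sup>2 / 2))"
    by (simp add: integral_std_gaussian_iexp exp_of_nat_mult[symmetric] flip: of_real_power)
  finally have *: "(CLINT x|gaussian_input k. iexp (\<Sum>i\<in>{1..k}. a \<bullet> x i)) =
      complex_of_real (exp (- real k * (norm a)\<^sup>2 / 2))" .
  have "integrable (gaussian_input k) (\<lambda>x. iexp (\<Sum>i\<in>{1..k}. a \<bullet> x i))"
    by (rule integrable_const_bound[where B = 1]) auto
  from integral_Re[OF this] show ?thesis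
    by (simp only: *) (simp add: Re_exp)
qed

lemma ws_objective_eq:
  fixes u w :: "real^'d"
  assumes "k \<ge> 1"
  shows "ws_objective k c u w = c\<^sup>2 / 2 * (norm (w - u))\<^sup>2
      + 1/4 * exp (- (4 * real k) * (norm w)\<^sup>2 / 2) + (1/2 + 1/4 * exp (- (4 * real k) * (norm u)\<^sup>2 / 2))
      - 1/2 * exp (- real k * (norm (w - u))\<^sup>2 / 2) - 1/2 * exp (- real k * (norm (w + u))\<^sup>2 / 2)"
proof -
  interpret prob_space "gaussian_input k :: (nat \<Rightarrow> real^'d) measure" by (rule prob_space_gaussian_input)
  define G :: "(nat \<Rightarrow> real^'d) measure" where "G = gaussian_input k"
  define S where "S v x = (\<Sum>i\<in>{1..k}. v \<bullet> x i)" for v :: "real^'d" and x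
  \<comment> \<open>This is where \<open>k \<ge> 1\<close> enters: \<open>x 1\<close> is a genuine
    coordinate of the product.\<close>
  have one: "1 \<in> {1..k}" using assms by simp
  have [measurable]: "(\<lambda>x. v \<bullet> x 1) \<in> borel_measurable G" for v :: "real^'d"
    unfolding G_def using one by measurable
  have [measurable]: "S v \<in> borel_measurable G" for v
    unfolding G_def S_def by measurable
  have cosS: "(LINT x|G. cos (S v x)) = exp (- real k * (norm v)\<^sup>2 / 2)" for v
    unfolding G_def S_def by (rule integral_gaussian_input_cos)
  have int_cos: "integrable G (\<lambda>x. cos (S v x))" for v
    unfolding G_def
    by (rule integrable_const_bound[where B = 1]) (auto simp flip: G_def)
  have comp: "(LINT x|std_gaussian. ((w - u) \<bullet> x) ^ n) = (LINT x|G. ((w - u) \<bullet> x 1) ^ n)"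
    "integrable G (\<lambda>x. ((w - u) \<bullet> x 1) ^ n)" for n
  proof -
    have m: "(\<lambda>x. x 1) \<in> measurable G (std_gaussian :: (real^'d) measure)"
      unfolding G_def gaussian_input_def using one by (rule measurable_component_singleton)
    have d: "std_gaussian = distr G std_gaussian (\<lambda>x. x 1)"
      unfolding G_def by (rule distr_gaussian_input_component[OF one, symmetric])
    show "(LINT x|std_gaussian. ((w - u) \<bullet> x) ^ n) = (LINT x|G. ((w - u) \<bullet> x 1) ^ n)"
      by (subst d, subst integral_distr[OF m]) auto
    show "integrable G (\<lambda>x. ((w - u) \<bullet> x 1) ^ n)"
      using integrable_std_gaussian_inner_power[of "w - u" n]
      by (subst (asm) d, subst (asm) integrable_distr_eq[OF m]) auto
  qed
  \<comment> \<open>An integrable linear form times a factor bounded by 2.\<close>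
  have int_cross: "integrable G (\<lambda>x. ((w - u) \<bullet> x 1) * (cos (S w x) - cos (S u x)))"
  proof (rule Bochner_Integration.integrable_bound[where f = "\<lambda>x. 2 * ((w - u) \<bullet> x 1)"])
    have "\<bar>cos (S w x) - cos (S u x)\<bar> \<le> 2" for x
      using cos_ge_minus_one[of "S w x"] cos_le_one[of "S w x"]
        cos_ge_minus_one[of "S u x"] cos_le_one[of "S u x"] by linarith
    then show "AE x in G. norm (((w - u) \<bullet> x 1) * (cos (S w x) - cos (S u x)))
        \<le> norm (2 * ((w - u) \<bullet> x 1))"
      by (auto simp: abs_mult mult.commute[of 2] intro!: mult_left_mono)
  qed (use comp(2)[of 1] in auto)
  have cross: "(LINT x|G. ((w - u) \<bullet> x 1) * (cos (S w x) - cos (S u x))) = 0"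
    unfolding G_def
  proof (rule integral_gaussian_input_odd)
    show "(\<lambda>x. ((w - u) \<bullet> x 1) * (cos (S w x) - cos (S u x))) \<in> borel_measurable (gaussian_input k)"
      unfolding G_def[symmetric] by measurable
  next
    fix x :: "nat \<Rightarrow> real^'d"
    have "S v (\<lambda>i\<in>{1..k}. - x i) = - S v x" for v
      by (simp add: S_def sum_negf)
    then show "((w - u) \<bullet> (\<lambda>i\<in>{1..k}. - x i) 1) *
        (cos (S w (\<lambda>i\<in>{1..k}. - x i)) - cos (S u (\<lambda>i\<in>{1..k}. - x i))) =
      - (((w - u) \<bullet> x 1) * (cos (S w x) - cos (S u x)))"
      using one by simp
  qed
  \<comment> \<open>\<open>S v x\<close> is linear in \<open>v\<close>, so the double-angle and
    addition formulas turn the squared difference of cosines into single cosines at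
    \<open>2w\<close>, \<open>2u\<close>, \<open>w - u\<close> and \<open>w + u\<close>, each with a
    known mean. The frequency \<open>2w\<close> produces the factor \<open>4 * k\<close> in the
    exponent.\<close>
  have expand: "1/2 * (ws_predictor k c w x - ws_predictor k c u x)\<^sup>2 =
      c\<^sup>2 / 2 * ((w - u) \<bullet> x 1)\<^sup>2 + c * (((w - u) \<bullet> x 1) * (cos (S w x) - cos (S u x)))
      + (1/2 + 1/4 * cos (S (2 *\<^sub>R w) x) + 1/4 * cos (S (2 *\<^sub>R u) x)
        - 1/2 * cos (S (w - u) x) - 1/2 * cos (S (w + u) x))" (is "_ = ?R x") for x
  proof -
    have S: "S (2 *\<^sub>R v) x = 2 * S v x" "S (w - u) x = S w x - S u x" "S (w + u) x = S w x + S u x" for v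
      by (simp_all add: S_def sum_distrib_left inner_diff_left inner_add_left sum_subtractf sum.distrib)
    show ?thesis
      unfolding S cos_double_cos cos_diff cos_add ws_predictor_def S_def[symmetric] inner_diff_left
      by (simp add: power2_eq_square algebra_simps)
  qed
  have "ws_objective k c u w = (LINT x|G. ?R x)"
    unfolding ws_objective_def G_def[symmetric] expand ..
  also have "\<dots> = c\<^sup>2 / 2 * (norm (w - u))\<^sup>2
      + (1/2 + 1/4 * exp (- real k * (norm (2 *\<^sub>R w))\<^sup>2 / 2) + 1/4 * exp (- real k * (norm (2 *\<^sub>R u))\<^sup>2 / 2)
      - 1/2 * exp (- real k * (norm (w - u))\<^sup>2 / 2) - 1/2 * exp (- real k * (norm (w + u))\<^sup>2 / 2))"
  proof -
    have 1: "integrable G (\<lambda>x. 1/2 :: real)" "(LINT x|G. 1/2) = (1/2 :: real)"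
      unfolding G_def by (simp_all add: prob_space)
    show ?thesis
      using comp(2)[of 2] int_cross int_cos 1
      by (simp add: cross cosS comp(1)[symmetric] integral_std_gaussian_inner_power2
          del: One_nat_def)
  qed
  finally show ?thesis
    by (simp add: power_mult_distrib algebra_simps)
qed

subsection \<open>Symmetric matrices and strongly convex functions\<close>

text \<open>A zero of a nonnegative form is a minimum, so the first-order variation there vanishes.
  Concretely, moving from \<open>v\<close> along \<open>- f v\<close> changes the form by
  \<open>- 2 * t * p + t\<^sup>2 * q\<close>, which is negative for small positive \<open>t\<close>
  unless \<open>p = 0\<close>.\<close>

lemma symmetric_quadratic_form_kernel:
  fixes f :: "'a::real_inner \<Rightarrow> 'a"
  assumes "linear f" and sym: "\<And>x y. f x \<bullet> y = x \<bullet> f y"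
    and nonneg: "\<And>x. 0 \<le> f x \<bullet> x" and "f v \<bullet> v = 0"
  shows "f v = 0"
proof (rule ccontr)
  interpret linear f by fact
  assume "f v \<noteq> 0"
  define p where "p = f v \<bullet> f v"
  define q where "q = f (f v) \<bullet> f v"
  have p: "p > 0" using \<open>f v \<noteq> 0\<close> by (simp add: p_def)
  have q: "q \<ge> 0" unfolding q_def by (rule nonneg)
  have "0 \<le> f (v - t *\<^sub>R f v) \<bullet> (v - t *\<^sub>R f v)" for t by (rule nonneg)
  also have "\<And>t. f (v - t *\<^sub>R f v) \<bullet> (v - t *\<^sub>R f v) = - 2 * t * p + t\<^sup>2 * q"
    using \<open>f v \<bullet> v = 0\<close> sym[of "f v" v]
    by (simp add: diff scale inner_diff_left inner_diff_right p_def q_def power2_eq_square algebra_simps)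
  finally have *: "0 \<le> - 2 * t * p + t\<^sup>2 * q" for t .
  \<comment> \<open>The choice \<open>t = p / (q + 1)\<close> nearly minimizes the quadratic; the
    added 1 covers the case \<open>q = 0\<close>.\<close>
  have "0 \<le> - 2 * (p / (q + 1)) * p + (p / (q + 1))\<^sup>2 * (q + 1)"
    using *[of "p / (q + 1)"] by (smt (verit) mult_left_mono zero_le_power2)
  also have "(p / (q + 1))\<^sup>2 * (q + 1) = p * p / (q + 1)"
    using q by (simp add: power2_eq_square divide_simps)
  finally have "p * p / (q + 1) \<le> 0" by (simp add: field_simps)
  then show False using p q by (simp add: divide_le_0_iff mult_le_0_iff)
qed

text \<open>By compactness the Rayleigh quotient attains its maximum \<open>l\<close> on the unit
  sphere at some \<open>v\<close>. Then \<open>l\<close> times the identity minus \<open>A\<close>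
  is positive semidefinite with form zero at \<open>v\<close>, so \<open>v\<close> lies in its
  kernel. With finiteness, this ensures that \<open>Max\<close> and \<open>Min\<close> of the
  spectrum are attained.\<close>

lemma symmetric_eigenvalues_nonempty:
  fixes A :: "real^'n^'n"
  assumes sym: "\<And>x y. (A *v x) \<bullet> y = x \<bullet> (A *v y)"
  shows "eigenvalues A \<noteq> {}"
proof -
  have "compact (sphere (0::real^'n) 1)" "sphere (0::real^'n) 1 \<noteq> {}"
    by auto
  moreover have "continuous_on (sphere 0 1) (\<lambda>x. (A *v x) \<bullet> x)"
    by (intro continuous_intros matrix_vector_mult_linear_continuous_on)
  ultimately obtain v where v: "norm v = 1"
    and max: "\<And>x. norm x = 1 \<Longrightarrow> (A *v x) \<bullet> x \<le> (A *v v) \<bullet> v"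
    using continuous_attains_sup[of "sphere (0::real^'n) 1" "\<lambda>x. (A *v x) \<bullet> x"] by auto
  define l where "l = (A *v v) \<bullet> v"
  define f where "f x = l *\<^sub>R x - A *v x" for x
  have "f v = 0"
  proof (rule symmetric_quadratic_form_kernel[of f v])
    show "linear f"
      unfolding f_def by (intro linear_compose_sub linear_scaleR matrix_vector_mul_linear)
    show "f x \<bullet> y = x \<bullet> f y" for x y
      by (simp add: f_def inner_diff_left inner_diff_right sym)
    show "f v \<bullet> v = 0"
      using v by (simp add: f_def inner_diff_left l_def flip: power2_norm_eq_inner)
    show "0 \<le> f x \<bullet> x" for x
    proof (cases "x = 0")
      case False
      have "(A *v sgn x) \<bullet> sgn x \<le> l"
        unfolding l_def using False by (intro max) (simp add: norm_sgn)
      then have "(A *v x) \<bullet> x \<le> l * (norm x)\<^sup>2"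
        using False by (simp add: sgn_div_norm matrix_vector_mult_scaleR field_simps power2_eq_square)
      then show ?thesis
        by (simp add: f_def inner_diff_left flip: power2_norm_eq_inner)
    qed (simp add: f_def)
  qed
  moreover have "v \<noteq> 0" using v by auto
  ultimately show ?thesis by (auto simp: eigenvalues_def f_def intro!: exI[of _ l] exI[of _ v])
qed

text \<open>Eigenvectors for distinct eigenvalues are orthogonal, hence independent, and an
  independent set is finite.\<close>

lemma symmetric_eigenvalues_finite:
  fixes A :: "real^'n^'n"
  assumes sym: "\<And>x y. (A *v x) \<bullet> y = x \<bullet> (A *v y)"
  shows "finite (eigenvalues A)"
proof -
  obtain e where e: "\<And>l. l \<in> eigenvalues A \<Longrightarrow> e l \<noteq> 0 \<and> A *v e l = l *\<^sub>R e l"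
    unfolding eigenvalues_def by (atomize_elim, rule choice) auto
  have orth: "orthogonal (e l) (e m)" if "l \<in> eigenvalues A" "m \<in> eigenvalues A" "l \<noteq> m" for l m
  proof -
    have "l * (e l \<bullet> e m) = m * (e l \<bullet> e m)"
      using sym[of "e l" "e m"] e[OF that(1)] e[OF that(2)] by simp
    then show ?thesis using that(3) by (simp add: orthogonal_def)
  qed
  have "pairwise orthogonal (e ` eigenvalues A)"
    using orth by (auto simp: pairwise_def)
  then have "finite (e ` eigenvalues A)"
    using e by (intro independent_imp_finite pairwise_orthogonal_independent) auto
  moreover have "inj_on e (eigenvalues A)"
    using orth e by (intro inj_onI) (metis orthogonal_self)
  ultimately show ?thesis by (rule finite_imageD)
qed

lemma eigenvalue_perturbed_identity:
  fixes A :: "real^'n^'n"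
  assumes "\<And>h. norm (A *v h - a *\<^sub>R h) \<le> B * norm h" and "l \<in> eigenvalues A"
  shows "\<bar>l - a\<bar> \<le> B"
proof -
  obtain v where v: "v \<noteq> 0" "A *v v = l *\<^sub>R v"
    using assms(2) by (auto simp: eigenvalues_def)
  then have "\<bar>l - a\<bar> * norm v \<le> B * norm v"
    using assms(1)[of v] by (simp flip: scaleR_diff_left)
  then show ?thesis using v by simp
qed

lemma lambda_perturbed_identity:
  fixes A :: "real^'n^'n"
  assumes sym: "\<And>x y. (A *v x) \<bullet> y = x \<bullet> (A *v y)"
    and near: "\<And>h. norm (A *v h - a *\<^sub>R h) \<le> B * norm h"
  shows "lambda_max A \<in> {a - B..a + B}" and "lambda_min A \<in> {a - B..a + B}"
proof -
  have "lambda_max A \<in> eigenvalues A" "lambda_min A \<in> eigenvalues A"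
    unfolding lambda_max_def lambda_min_def
    using symmetric_eigenvalues_finite[OF sym] symmetric_eigenvalues_nonempty[OF sym] by auto
  then show "lambda_max A \<in> {a - B..a + B}" "lambda_min A \<in> {a - B..a + B}"
    using eigenvalue_perturbed_identity[OF near] by (fastforce simp: abs_le_iff)+
qed

section \<open>Gradients and strong convexity\<close>

lemma gradient_eqI:
  assumes "GDERIV f x :> g"
  shows "gradient f x = g"
  unfolding gradient_def
proof (rule the_equality)
  show "GDERIV f x :> g" by fact
next
  fix g' assume "GDERIV f x :> g'"
  then have "(\<lambda>h. h \<bullet> g') = (\<lambda>h. h \<bullet> g)"
    using assms has_derivative_unique unfolding gderiv_def by blast
  then show "g' = g"
    by (meson vector_eq_ldot)
qed

text \<open>On the segment from \<open>x\<close> to \<open>y\<close>, subtracting the parabola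
  \<open>m / 2 * s\<^sup>2 * N\<close> leaves a function with nondecreasing derivative, hence a
  convex one. Convexity between 0 and 1 is the claim, since the parabola contributes the term in
  \<open>t * (1 - t)\<close>.\<close>

lemma strongly_convex_if_gradient_strongly_monotone:
  fixes f :: "'a::real_inner \<Rightarrow> real"
  assumes grad: "\<And>x. GDERIV f x :> g x" and "m > 0"
    and mono: "\<And>x y. m * (norm (x - y))\<^sup>2 \<le> (g x - g y) \<bullet> (x - y)"
  shows "strongly_convex f"
  unfolding strongly_convex_def
proof (intro exI[of _ m] conjI allI ballI \<open>m > 0\<close>)
  fix x y :: 'a and t :: real assume t: "t \<in> {0..1}"
  define z where "z s = x + s *\<^sub>R (y - x)" for s
  define N where "N = (norm (y - x))\<^sup>2"
  define \<phi> where "\<phi> s = f (z s) - m / 2 * s\<^sup>2 * N" for s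
  have "convex_on UNIV \<phi>"
  proof (rule convex_on_realI)
    fix s :: real
    have "(z has_derivative (\<lambda>r. r *\<^sub>R (y - x))) (at s)"
      unfolding z_def by (auto intro!: derivative_eq_intros)
    from has_derivative_compose[OF this grad[of "z s", unfolded gderiv_def]]
    have "((\<lambda>s. f (z s)) has_real_derivative (y - x) \<bullet> g (z s)) (at s)"
      by (simp add: has_field_derivative_def mult_commute_abs)
    then show "(\<phi> has_real_derivative (y - x) \<bullet> g (z s) - m * s * N) (at s)"
      unfolding \<phi>_def by (auto intro!: derivative_eq_intros)
  next
    fix r s :: real assume rs: "r \<le> s"
    have "m * ((s - r)\<^sup>2 * N) \<le> (s - r) * ((y - x) \<bullet> g (z s) - (y - x) \<bullet> g (z r))"
      using mono[of "z s" "z r"]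
      by (simp add: z_def N_def power_mult_distrib inner_diff_right inner_commute right_diff_distrib
          flip: scaleR_diff_left)
    then have "(s - r) * (m * ((s - r) * N)) \<le> (s - r) * ((y - x) \<bullet> g (z s) - (y - x) \<bullet> g (z r))"
      by (simp add: power2_eq_square algebra_simps)
    then have "m * ((s - r) * N) \<le> (y - x) \<bullet> g (z s) - (y - x) \<bullet> g (z r)" if "r < s"
      using that by simp
    then show "(y - x) \<bullet> g (z r) - m * r * N \<le> (y - x) \<bullet> g (z s) - m * s * N"
      using rs by (cases "r = s") (auto simp: algebra_simps)
  qed auto
  then have "\<phi> ((1 - t) *\<^sub>R 0 + t *\<^sub>R 1) \<le> (1 - t) * \<phi> 0 + t * \<phi> 1"
    using t by (intro convex_onD) auto
  moreover have "z t = (1 - t) *\<^sub>R x + t *\<^sub>R y" "z 0 = x" "z 1 = y"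
    by (simp_all add: z_def algebra_simps)
  ultimately show "f ((1 - t) *\<^sub>R x + t *\<^sub>R y)
      \<le> (1 - t) * f x + t * f y - m / 2 * t * (1 - t) * (norm (x - y))\<^sup>2"
    by (simp add: \<phi>_def N_def norm_minus_commute power2_eq_square algebra_simps diff_divide_distrib)
qed

subsection \<open>Gaussian bumps\<close>

text \<open>Minus the gradient of the Gaussian bump
  \<open>exp (- b * (norm v)\<^sup>2 / 2)\<close>.\<close>

definition bump_grad :: "real \<Rightarrow> 'a::real_inner \<Rightarrow> 'a" where
  "bump_grad b v = (b * exp (- b * (norm v)\<^sup>2 / 2)) *\<^sub>R v"

text \<open>Minus the Hessian of the same bump at \<open>v\<close>, as a linear map in
  \<open>h\<close>.\<close>

definition bump_hess :: "real \<Rightarrow> 'a::real_inner \<Rightarrow> 'a \<Rightarrow> 'a" where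
  "bump_hess b v h = (b * exp (- b * (norm v)\<^sup>2 / 2)) *\<^sub>R h
     - (b\<^sup>2 * exp (- b * (norm v)\<^sup>2 / 2) * (v \<bullet> h)) *\<^sub>R v"

lemma has_derivative_bump:
  "((\<lambda>v. exp (- b * (norm v)\<^sup>2 / 2)) has_derivative (\<lambda>h. - (h \<bullet> bump_grad b v))) (at v)"
  unfolding bump_grad_def power2_norm_eq_inner
  by (auto intro!: derivative_eq_intros simp: inner_commute field_simps)

lemma has_derivative_bump_grad:
  "(bump_grad b has_derivative bump_hess b v) (at v)"
proof -
  have "((\<lambda>v. (b * exp (- b * (norm v)\<^sup>2 / 2)) *\<^sub>R v) has_derivative
      (\<lambda>h. (b * exp (- b * (norm v)\<^sup>2 / 2)) *\<^sub>R h + (b * - (h \<bullet> bump_grad b v)) *\<^sub>R v)) (at v)"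
    by (intro has_derivative_scaleR has_derivative_mult_right has_derivative_bump has_derivative_ident)
  then show ?thesis
    unfolding bump_grad_def[abs_def] bump_hess_def[abs_def]
    by (simp add: inner_commute power2_eq_square mult.assoc)
qed

lemma has_derivative_bump_shift:
  "((\<lambda>w. exp (- b * (norm (w + p))\<^sup>2 / 2)) has_derivative (\<lambda>h. - (h \<bullet> bump_grad b (w + p)))) (at w)"
  by (rule has_derivative_compose[OF has_derivative_add_const[OF has_derivative_ident]
        has_derivative_bump])

lemma has_derivative_bump_grad_shift:
  "((\<lambda>w. bump_grad b (w + p)) has_derivative bump_hess b (w + p)) (at w)"
  by (rule has_derivative_compose[OF has_derivative_add_const[OF has_derivative_ident]
        has_derivative_bump_grad])

lemma bump_hess_symmetric: "bump_hess b v x \<bullet> y = x \<bullet> bump_hess b v y"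
  by (simp add: bump_hess_def inner_diff_left inner_diff_right inner_commute)

text \<open>With \<open>s = b * (norm v)\<^sup>2 / 2\<close>, the two terms have norms at most
  \<open>exp (- s)\<close> and \<open>2 * s * exp (- s)\<close> times \<open>b * norm h\<close>, and
  both factors are at most 1.\<close>

lemma norm_bump_hess_le:
  assumes "b \<ge> 0"
  shows "norm (bump_hess b v h) \<le> 2 * b * norm h"
proof -
  define s where "s = b * (norm v)\<^sup>2 / 2"
  have s: "s \<ge> 0" using assms by (simp add: s_def)
  have e: "exp (- s) \<le> 1" using s by simp
  \<comment> \<open>The Taylor bound \<open>1 + s + s\<^sup>2 / 2\<close> exceeds
    \<open>2 * s\<close> by \<open>((s - 1)\<^sup>2 + 1) / 2\<close>.\<close>
  have "2 * s \<le> exp s"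
    using exp_lower_Taylor_quadratic[OF s] zero_le_power2[of "s - 1"]
    by (simp add: power2_eq_square algebra_simps)
  then have se: "2 * s * exp (- s) \<le> 1"
    by (simp add: exp_minus field_simps)
  have "norm (bump_hess b v h) \<le>
      norm ((b * exp (- s)) *\<^sub>R h) + norm ((b\<^sup>2 * exp (- s) * (v \<bullet> h)) *\<^sub>R v)"
    unfolding bump_hess_def s_def by (rule order_trans[OF norm_triangle_ineq4]) simp
  also have "\<dots> = b * exp (- s) * norm h + b\<^sup>2 * exp (- s) * \<bar>v \<bullet> h\<bar> * norm v"
    using assms by (simp add: abs_mult)
  also have "\<dots> \<le> b * exp (- s) * norm h + b\<^sup>2 * exp (- s) * (norm v * norm h) * norm v"
    by (intro add_left_mono mult_right_mono mult_left_mono Cauchy_Schwarz_ineq2) auto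
  also have "\<dots> = b * norm h * exp (- s) + b * norm h * (2 * s * exp (- s))"
    by (simp add: s_def power2_eq_square)
  also have "\<dots> \<le> b * norm h * 1 + b * norm h * 1"
    using assms e se by (intro add_mono mult_left_mono) auto
  finally show ?thesis by simp
qed

subsection \<open>Convergence of gradient descent\<close>

lemma gd_iterate_contraction:
  assumes contr: "\<And>w. norm (w - \<eta> *\<^sub>R gradient f w - u) \<le> q * norm (w - u)" and "q \<ge> 0"
  shows "norm (gd_iterate \<eta> f w t - u) \<le> q ^ t * norm (w - u)"
proof (induction t)
  case (Suc t)
  have "norm (gd_iterate \<eta> f w (Suc t) - u) \<le> q * norm (gd_iterate \<eta> f w t - u)"
    using contr[of "gd_iterate \<eta> f w t"] by simp
  also have "\<dots> \<le> q * (q ^ t * norm (w - u))"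
    by (intro mult_left_mono Suc.IH \<open>q \<ge> 0\<close>)
  finally show ?case by (simp add: mult.assoc)
qed simp

lemma geometric_rate_iterations:
  fixes q r \<epsilon> K :: real
  assumes "0 \<le> q" "q \<le> exp (- 1 / K)" "K > 0" "r > 0" "\<epsilon> > 0"
  shows "q ^ nat \<lceil>K * ln (r / \<epsilon>)\<rceil> * r \<le> \<epsilon>"
proof -
  define n where "n = nat \<lceil>K * ln (r / \<epsilon>)\<rceil>"
  \<comment> \<open>If the ceiling is negative, \<open>nat\<close> makes \<open>n\<close> zero,
    which is still an upper bound.\<close>
  have "K * ln (r / \<epsilon>) \<le> real n"
    unfolding n_def by linarith
  then have "ln (r / \<epsilon>) \<le> real n / K"
    using \<open>K > 0\<close> by (simp add: field_simps)
  then have "r / \<epsilon> \<le> exp (real n / K)"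
    using assms by (metis divide_pos_pos exp_le_cancel_iff exp_ln)
  then have "r \<le> \<epsilon> * exp (real n / K)"
    using assms by (simp add: field_simps)
  moreover have "q ^ n \<le> exp (- (real n / K))"
    using power_mono[OF assms(2,1), of n] by (simp flip: exp_of_nat_mult)
  ultimately have "q ^ n * r \<le> exp (- (real n / K)) * (\<epsilon> * exp (real n / K))"
    using assms by (intro mult_mono) auto
  also have "\<dots> = \<epsilon>" by (simp add: exp_minus)
  finally show ?thesis by (simp add: n_def)
qed

section \<open>Spectral bounds and convergence for the objective\<close>

theorem theorem2:
  fixes k :: nat and c :: real and u\<^sub>0 :: "real^'d" and F :: "real^'d \<Rightarrow> real"
  assumes "k \<ge> 1"
    and "c \<ge> 3 * sqrt (real k)"
    and "F = ws_objective k c u\<^sub>0"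
  shows "strongly_convex F
    \<and> (\<forall>w. F u\<^sub>0 \<le> F w)
    \<and> (\<forall>w. F differentiable (at w) \<and> gradient F differentiable (at w))
    \<and> bdd_above (range (\<lambda>w. lambda_max (hessian F w)))
    \<and> bdd_below (range (\<lambda>w. lambda_min (hessian F w)))
    \<and> 0 < (INF w. lambda_min (hessian F w))
    \<and> (SUP w. lambda_max (hessian F w)) / (INF w. lambda_min (hessian F w)) \<le> 5
    \<and> (\<exists>\<eta>>0. \<forall>\<epsilon>>0. \<forall>w\<^sub>0. \<exists>t::nat.
          int t \<le> (if w\<^sub>0 = u\<^sub>0 then 0 else max 0 \<lceil>5 * ln (norm (w\<^sub>0 - u\<^sub>0) / \<epsilon>)\<rceil>)
          \<and> norm (gd_iterate \<eta> F w\<^sub>0 t - u\<^sub>0) \<le> \<epsilon>)"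
proof -
  define K where "K = real k"
  define C where "C = c\<^sup>2"
  \<comment> \<open>\<open>R\<close> is the gradient of the bump part of \<open>F\<close> and
    \<open>H\<close> its derivative. The signs are opposite to those in
    \<open>ws_objective_eq\<close> because \<open>bump_grad\<close> is minus a gradient.\<close>
  define R where "R w = (1/2) *\<^sub>R bump_grad K (w - u\<^sub>0) + (1/2) *\<^sub>R bump_grad K (w + u\<^sub>0)
      - (1/4) *\<^sub>R bump_grad (4 * K) w" for w :: "real^'d"
  define H where "H w h = (1/2) *\<^sub>R bump_hess K (w - u\<^sub>0) h + (1/2) *\<^sub>R bump_hess K (w + u\<^sub>0) h
      - (1/4) *\<^sub>R bump_hess (4 * K) w h" for w h :: "real^'d"
  define g where "g w = C *\<^sub>R (w - u\<^sub>0) + R w" for w :: "real^'d"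
  have K: "K \<ge> 1" using assms(1) by (simp add: K_def)
  have "(3 * sqrt K)\<^sup>2 \<le> c\<^sup>2"
    using assms(2) K by (intro power_mono) (auto simp: K_def)
  then have C: "9 * K \<le> C"
    using K by (simp add: C_def power_mult_distrib)

  have grad: "GDERIV F w :> g w" for w
  proof -
    \<comment> \<open>\<open>z\<close> collects the terms independent of \<open>w\<close>; writing
      \<open>w + - u\<^sub>0\<close> below fits the shifted derivative rule.\<close>
    define z where "z = 1/2 + 1/4 * exp (- (4 * K) * (norm u\<^sub>0)\<^sup>2 / 2)"
    have F: "F = (\<lambda>w. C / 2 * ((w - u\<^sub>0) \<bullet> (w - u\<^sub>0)) + 1/4 * exp (- (4 * K) * (norm w)\<^sup>2 / 2) + z
        - 1/2 * exp (- K * (norm (w + - u\<^sub>0))\<^sup>2 / 2) - 1/2 * exp (- K * (norm (w + u\<^sub>0))\<^sup>2 / 2))"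
      unfolding assms(3) ws_objective_eq[OF assms(1)] K_def C_def z_def by (simp add: power2_norm_eq_inner)
    have "(F has_derivative (\<lambda>h. C / 2 * ((w - u\<^sub>0) \<bullet> (h - 0) + (h - 0) \<bullet> (w - u\<^sub>0))
        + 1/4 * - (h \<bullet> bump_grad (4 * K) w) + 0
        - 1/2 * - (h \<bullet> bump_grad K (w + - u\<^sub>0)) - 1/2 * - (h \<bullet> bump_grad K (w + u\<^sub>0)))) (at w)"
      unfolding F
      by (intro has_derivative_add has_derivative_diff has_derivative_mult_right has_derivative_inner
            has_derivative_const has_derivative_ident has_derivative_bump has_derivative_bump_shift)
    then show ?thesis
      unfolding gderiv_def
      by (rule has_derivative_eq_rhs)
        (auto simp: fun_eq_iff g_def R_def inner_diff_right inner_add_right inner_commute algebra_simps)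
  qed
  have gradF: "gradient F = g"
    using gradient_eqI[OF grad] by blast
  have deriv_R: "(R has_derivative H w) (at w)" for w
  proof -
    have "((\<lambda>w. bump_grad K (w - u\<^sub>0)) has_derivative bump_hess K (w - u\<^sub>0)) (at w)"
      using has_derivative_bump_grad_shift[of K "- u\<^sub>0" w] by simp
    then show ?thesis
      unfolding R_def H_def
      by (intro derivative_intros has_derivative_bump_grad has_derivative_bump_grad_shift)
  qed
  have deriv_g: "(g has_derivative (\<lambda>h. C *\<^sub>R h + H w h)) (at w)" for w
    unfolding g_def by (auto intro!: derivative_eq_intros deriv_R)
  \<comment> \<open>The three bumps contribute \<open>1/2 * 2K\<close>, \<open>1/2 * 2K\<close> and
    \<open>1/4 * 8K\<close>.\<close>
  have norm_H: "norm (H w h) \<le> 4 * K * norm h" for w h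
  proof -
    have "norm (H w h) \<le> norm ((1/2) *\<^sub>R bump_hess K (w - u\<^sub>0) h)
        + norm ((1/2) *\<^sub>R bump_hess K (w + u\<^sub>0) h) + norm ((1/4) *\<^sub>R bump_hess (4 * K) w h)"
      unfolding H_def by (meson add_right_mono norm_triangle_ineq norm_triangle_ineq4 order_trans)
    then show ?thesis
      using norm_bump_hess_le[of K "w - u\<^sub>0" h] norm_bump_hess_le[of K "w + u\<^sub>0" h]
        norm_bump_hess_le[of "4 * K" w h] K by simp
  qed
  \<comment> \<open>Mean value inequality with the uniform bound on \<open>H\<close>.\<close>
  have lip: "norm (R x - R y) \<le> 4 * K * norm (x - y)" for x y
    by (rule differentiable_bound[OF convex_UNIV deriv_R]) (auto intro: onorm_le norm_H)
  \<comment> \<open>The bump centred at \<open>u\<^sub>0\<close> is stationary there; the other two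
    cancel, since doubling the vector matches quadrupling the parameter in the exponent.\<close>
  have R0: "R u\<^sub>0 = 0"
    by (simp add: R_def bump_grad_def power_mult_distrib flip: scaleR_2 scaleR_diff_left)

  have hess: "hessian F w *v h = C *\<^sub>R h + H w h" for w h
  proof -
    have "g differentiable (at w)"
      using deriv_g differentiable_def by blast
    then have "(g has_derivative (\<lambda>h. hessian F w *v h)) (at w)"
      unfolding hessian_def gradF by (simp flip: jacobian_works)
    from has_derivative_unique[OF this deriv_g] show ?thesis
      by (rule fun_cong)
  qed
  \<comment> \<open>The Hessian is \<open>C\<close> times the identity plus a symmetric perturbation
    of norm at most \<open>4 * K\<close>.\<close>
  have lambda: "lambda_max (hessian F w) \<in> {C - 4 * K..C + 4 * K}"
      "lambda_min (hessian F w) \<in> {C - 4 * K..C + 4 * K}" for w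
  proof -
    have sym: "(hessian F w *v x) \<bullet> y = x \<bullet> (hessian F w *v y)" for x y
      by (simp add: hess H_def inner_add_left inner_add_right inner_diff_left inner_diff_right
          bump_hess_symmetric)
    have near: "norm (hessian F w *v h - C *\<^sub>R h) \<le> 4 * K * norm h" for h
      by (simp add: hess norm_H)
    show "lambda_max (hessian F w) \<in> {C - 4 * K..C + 4 * K}"
        "lambda_min (hessian F w) \<in> {C - 4 * K..C + 4 * K}"
      by (rule lambda_perturbed_identity[OF sym near])+
  qed
  have sup: "(SUP w. lambda_max (hessian F w)) \<le> C + 4 * K"
    using lambda(1) by (intro cSUP_least) auto
  have inf: "C - 4 * K \<le> (INF w. lambda_min (hessian F w))"
    using lambda(2) by (intro cINF_greatest) auto

  have "strongly_convex F"
  proof (rule strongly_convex_if_gradient_strongly_monotone[OF grad])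
    show "0 < C - 4 * K" using C K by simp
    fix x y
    have "\<bar>(R x - R y) \<bullet> (x - y)\<bar> \<le> norm (R x - R y) * norm (x - y)"
      by (rule Cauchy_Schwarz_ineq2)
    also have "\<dots> \<le> 4 * K * norm (x - y) * norm (x - y)"
      by (intro mult_right_mono lip) auto
    finally have "- (4 * K * (norm (x - y))\<^sup>2) \<le> (R x - R y) \<bullet> (x - y)"
      by (simp add: power2_eq_square)
    moreover have "g x - g y = C *\<^sub>R (x - y) + (R x - R y)"
      by (simp add: g_def algebra_simps)
    ultimately show "(C - 4 * K) * (norm (x - y))\<^sup>2 \<le> (g x - g y) \<bullet> (x - y)"
      by (simp add: inner_add_left left_diff_distrib power2_norm_eq_inner)
  qed
  \<comment> \<open>The integrand is a square that vanishes identically at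
    \<open>u\<^sub>0\<close>.\<close>
  moreover have "F u\<^sub>0 \<le> F w" for w
    by (simp add: assms(3) ws_objective_def)
  moreover have "F differentiable (at w) \<and> gradient F differentiable (at w)" for w
    using grad[of w] deriv_g[of w] unfolding gradF gderiv_def differentiable_def by blast
  moreover have "bdd_above (range (\<lambda>w. lambda_max (hessian F w)))"
    using lambda(1) by (intro bdd_aboveI[of _ "C + 4 * K"]) auto
  moreover have "bdd_below (range (\<lambda>w. lambda_min (hessian F w)))"
    using lambda(2) by (intro bdd_belowI[of _ "C - 4 * K"]) auto
  moreover have inf_pos: "0 < (INF w. lambda_min (hessian F w))"
    using inf C K by linarith
  moreover have "(SUP w. lambda_max (hessian F w)) / (INF w. lambda_min (hessian F w)) \<le> 5"
  proof -
    \<comment> \<open>\<open>C + 4 * K \<le> 5 * (C - 4 * K)\<close> amounts to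
      \<open>6 * K \<le> C\<close>, which follows from \<open>9 * K \<le> C\<close>.\<close>
    have "(SUP w. lambda_max (hessian F w)) \<le> 5 * (INF w. lambda_min (hessian F w))"
      using sup inf C K by linarith
    then show ?thesis using inf_pos by (simp add: divide_le_eq)
  qed
  moreover have "\<exists>\<eta>>0. \<forall>\<epsilon>>0. \<forall>w\<^sub>0. \<exists>t::nat.
          int t \<le> (if w\<^sub>0 = u\<^sub>0 then 0 else max 0 \<lceil>5 * ln (norm (w\<^sub>0 - u\<^sub>0) / \<epsilon>)\<rceil>)
          \<and> norm (gd_iterate \<eta> F w\<^sub>0 t - u\<^sub>0) \<le> \<epsilon>"
  proof (intro exI[of _ "1 / C"] conjI allI impI)
    show "0 < 1 / C" using C K by simp
    have contr: "norm (w - (1 / C) *\<^sub>R gradient F w - u\<^sub>0) \<le> 4/9 * norm (w - u\<^sub>0)" for w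
    proof -
      \<comment> \<open>The step size \<open>1 / C\<close> cancels the quadratic part exactly; only
        the bump gradient remains, and it is Lipschitz and zero at \<open>u\<^sub>0\<close>.\<close>
      have "w - (1 / C) *\<^sub>R gradient F w - u\<^sub>0 = - ((1 / C) *\<^sub>R R w)"
        using C K by (simp add: gradF g_def scaleR_add_right)
      then have "norm (w - (1 / C) *\<^sub>R gradient F w - u\<^sub>0) = norm (R w) / C"
        using C K by simp
      also have "norm (R w) \<le> 4 * K * norm (w - u\<^sub>0)"
        using lip[of w u\<^sub>0] R0 by simp
      also have "\<dots> / C \<le> 4/9 * norm (w - u\<^sub>0)"
      proof -
        have "4 * K * norm (w - u\<^sub>0) \<le> 4/9 * C * norm (w - u\<^sub>0)"
          using C by (intro mult_right_mono) auto
        then show ?thesis using C K by (simp add: divide_le_eq mult_ac)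
      qed
      finally show ?thesis using C K by (simp add: divide_right_mono)
    qed
    fix \<epsilon> :: real and w\<^sub>0 :: "real^'d" assume "\<epsilon> > 0"
    define n where "n = nat \<lceil>5 * ln (norm (w\<^sub>0 - u\<^sub>0) / \<epsilon>)\<rceil>"
    show "\<exists>t::nat. int t \<le> (if w\<^sub>0 = u\<^sub>0 then 0 else max 0 \<lceil>5 * ln (norm (w\<^sub>0 - u\<^sub>0) / \<epsilon>)\<rceil>)
          \<and> norm (gd_iterate (1 / C) F w\<^sub>0 t - u\<^sub>0) \<le> \<epsilon>"
    proof (cases "w\<^sub>0 = u\<^sub>0")
      \<comment> \<open>Reading log 0 as minus infinity leaves a budget of zero iterations, and the
        distance is already zero.\<close>
      case True
      then show ?thesis using \<open>\<epsilon> > 0\<close> by (intro exI[of _ 0]) simp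
    next
      case False
      have "norm (gd_iterate (1 / C) F w\<^sub>0 n - u\<^sub>0) \<le> (4/9) ^ n * norm (w\<^sub>0 - u\<^sub>0)"
        by (rule gd_iterate_contraction[OF contr]) simp
      also have "\<dots> \<le> \<epsilon>"
        unfolding n_def
        \<comment> \<open>The rate needed is \<open>4/9 \<le> exp (- 1/5)\<close>, and
          \<open>exp (- 1/5)\<close> is at least \<open>4/5\<close>.\<close>
        using exp_ge_add_one_self[of "- 1/5"] False \<open>\<epsilon> > 0\<close>
        by (intro geometric_rate_iterations) auto
      finally show ?thesis
        using False by (intro exI[of _ n]) (auto simp: n_def)
    qed
  qed
  ultimately show ?thesis by blast
qed

end
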